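(* Let $A\in\mathbb{R}^{m\times n}$, $L\in\mathbb{R}^{p\times n}$, $M=A^{\top}A+L^{\top}L$, and let $\mathcal{A}:(\mathcal{R}(M),\langle\cdot,\cdot\rangle_M)\to(\mathbb{R}^m,\langle\cdot,\cdot\rangle_2)$, $v\mapsto Av$. Let $b\in\mathbb{R}^m$ be nonzero, run the gGKB process for $(A,M)$ with starting vector $b$ (described in the context), and let $k\ge1$ be such that it does not terminate before the $k$-th step, i.e. $\alpha_i\beta_i\ne0$ for $1\le i\le k$. Let $B_k=Y_k\Theta_kH_k^{\top}$ be the compact SVD of the bidiagonal matrix $B_k\in\mathbb{R}^{(k+1)\times k}$, with $\Theta_k=\mathrm{diag}(\theta_1^{(k)},\dots,\theta_k^{(k)})$, $\theta_1^{(k)}>\cdots>\theta_k^{(k)}>0$, $Y_k=(y_1^{(k)},\dots,y_k^{(k)})$ and $H_k=(h_1^{(k)},\dots,h_k^{(k)})$ having orthonormal columns. For $1\le i\le k$ define the approximate SVE triplet $$\bigl(\bar c_i^{(k)},\bar p_{A,i}^{(k)},\bar x_i^{(k)}\bigr)=\bigl(\theta_i^{(k)},\,U_{k+1}y_i^{(k)},\,V_kh_i^{(k)}\bigr).$$ Then for each $1\le i\le k$ $$\mathcal{A}\bar x_i^{(k)}-\bar c_i^{(k)}\bar p_{A,i}^{(k)}=\mathbf{0},\qquad \mathcal{A}^*\bar p_{A,i}^{(k)}-\bar c_i^{(k)}\bar x_i^{(k)}=\alpha_{k+1}v_{k+1}e_{k+1}^{\top}y_i^{(k)},$$ where $e_{k+1}$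 is the $(k+1)$-th column of $I_{k+1}$.
   Context: $\mathcal{R}(\cdot)$ is the column space; $\langle v,v'\rangle_M=v^{\top}Mv'$ is an inner product on $\mathcal{R}(M)$ with norm $\|v\|_M$; $\langle\cdot,\cdot\rangle_2$ is the Euclidean inner product; $M^{\dag}$ is the Moore-Penrose pseudoinverse. $\mathcal{A}^*:\mathbb{R}^m\to\mathcal{R}(M)$ is the adjoint: $\langle\mathcal{A}v,u\rangle_2=\langle v,\mathcal{A}^*u\rangle_M$ for all $v\in\mathcal{R}(M)$, $u\in\mathbb{R}^m$. gGKB process (Euclidean inner product on $\mathbb{R}^m$): $v_0=\mathbf{0}$, $\beta_1u_1=b$, and for $i\ge1$ $$\alpha_iv_i=M^{\dag}A^{\top}u_i-\beta_iv_{i-1},\qquad \beta_{i+1}u_{i+1}=Av_i-\alpha_iu_i,$$ where $\alpha_i\ge0,\beta_i\ge0$ are chosen so that $\|v_i\|_M=\|u_i\|_2=1$ (normalization of the right-hand sides). Convention at termination: if $\beta_{k+1}=0$ then $u_{k+1}=\mathbf{0}$, $\alpha_{k+1}=0$ and $v_{k+1}=\mathbf{0}$; if $\alpha_{k+1}=0$ then $v_{k+1}=\mathbf{0}$. Set $U_{k+1}=(u_1,\dots,u_{k+1})$, $V_k=(v_1,\dots,v_k)$, and let $B_k\in\mathbb{R}^{(k+1)\times k}$ be the lower bidiagonal matrix with $(B_k)_{ii}=\alpha_i$ and $(B_k)_{i+1,i}=\beta_{i+1}$, $1\le i\le k$, all other entries zero. *)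

theory Defs
  imports Complex_Main "Jordan_Normal_Form.VS_Connect"
begin

text \<open>
  Vectors and matrices of arbitrary real dimensions are those of Jordan-Normal-Form. Its entries,
  rows and columns are indexed from 0; the sequences of the bidiagonalization process and the
  singular values keep the indices from 1 on.
\<close>

abbreviation column_space :: "real mat \<Rightarrow> real vec set" where
  "column_space M \<equiv> vec_space.col_space (dim_row M) M"

definition inner_M :: "real mat \<Rightarrow> real vec \<Rightarrow> real vec \<Rightarrow> real" where
  "inner_M M v w = v \<bullet> (M *\<^sub>v w)"

definition norm_M :: "real mat \<Rightarrow> real vec \<Rightarrow> real" where
  "norm_M M v = sqrt (inner_M M v v)"

definition norm_2 :: "real vec \<Rightarrow> real" where
  "norm_2 u = sqrt (u \<bullet> u)"

definition is_moore_penrose :: "real mat \<Rightarrow> real mat \<Rightarrow> bool" where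
  "is_moore_penrose M X \<longleftrightarrow>
     X \<in> carrier_mat (dim_col M) (dim_row M) \<and>
     M * X * M = M \<and>
     X * M * X = X \<and>
     transpose_mat (M * X) = M * X \<and>
     transpose_mat (X * M) = X * M"

definition pinv :: "real mat \<Rightarrow> real mat" where
  "pinv M = (THE X. is_moore_penrose M X)"

text \<open>The operator \<open>v \<mapsto> A v\<close> with domain the column space of \<open>M\<close> (undefined elsewhere).\<close>

definition sve_op :: "real mat \<Rightarrow> real mat \<Rightarrow> real vec \<Rightarrow> real vec" where
  "sve_op A M = restrict (\<lambda>v. A *\<^sub>v v) (column_space M)"

text \<open>
  The value at \<open>u\<close> of the adjoint of an operator \<open>T\<close> from the column space of \<open>M\<close>, with the inner
  product of \<open>M\<close>, to the Euclidean space.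
\<close>

definition adjoint_M :: "real mat \<Rightarrow> (real vec \<Rightarrow> real vec) \<Rightarrow> real vec \<Rightarrow> real vec" where
  "adjoint_M M T u =
     (THE w. w \<in> column_space M \<and> (\<forall>v\<in>column_space M. T v \<bullet> u = inner_M M v w))"

text \<open>
  The sequences of a gGKB process. The coefficients normalize the right-hand sides; if a right-hand
  side vanishes, no unit vector is produced, and the coefficient and the vector are zero. All
  sequences are thereby continued by zero after the termination of the process. The values
  \<open>u 0\<close>, \<open>\<alpha> 0\<close> and \<open>\<beta> 0\<close> are irrelevant.
\<close>

definition gGKB ::
  "real mat \<Rightarrow> real mat \<Rightarrow> real vec \<Rightarrow> (nat \<Rightarrow> real) \<Rightarrow> (nat \<Rightarrow> real)
     \<Rightarrow> (nat \<Rightarrow> real vec) \<Rightarrow> (nat \<Rightarrow> real vec) \<Rightarrow> bool" where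
  "gGKB A M b \<alpha> \<beta> u v \<longleftrightarrow>
     v 0 = 0\<^sub>v (dim_col A) \<and>
     \<beta> 1 \<cdot>\<^sub>v u 1 = b \<and>
     (\<forall>i\<ge>1.
        u i \<in> carrier_vec (dim_row A) \<and> v i \<in> carrier_vec (dim_col A) \<and>
        \<alpha> i \<ge> 0 \<and> \<beta> i \<ge> 0 \<and>
        \<alpha> i \<cdot>\<^sub>v v i = pinv M *\<^sub>v (transpose_mat A *\<^sub>v u i) - \<beta> i \<cdot>\<^sub>v v (i - 1) \<and>
        \<beta> (i + 1) \<cdot>\<^sub>v u (i + 1) = A *\<^sub>v v i - \<alpha> i \<cdot>\<^sub>v u i \<and>
        (\<beta> i \<noteq> 0 \<longrightarrow> norm_2 (u i) = 1) \<and>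
        (\<alpha> i \<noteq> 0 \<longrightarrow> norm_M M (v i) = 1) \<and>
        (\<beta> i = 0 \<longrightarrow> u i = 0\<^sub>v (dim_row A) \<and> \<alpha> i = 0 \<and> v i = 0\<^sub>v (dim_col A)) \<and>
        (\<alpha> i = 0 \<longrightarrow> v i = 0\<^sub>v (dim_col A)))"

text \<open>The matrix with columns \<open>w 1, \<dots>, w k\<close> of length \<open>d\<close>.\<close>

definition cols_upto :: "nat \<Rightarrow> (nat \<Rightarrow> real vec) \<Rightarrow> nat \<Rightarrow> real mat" where
  "cols_upto d w k = mat_of_cols d (map w [1..<k + 1])"

text \<open>With indices from 0, entry \<open>(j, j)\<close> is \<open>\<alpha> (j + 1)\<close> and entry \<open>(j + 1, j)\<close> is \<open>\<beta> (j + 2)\<close>.\<close>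

definition bidiag :: "(nat \<Rightarrow> real) \<Rightarrow> (nat \<Rightarrow> real) \<Rightarrow> nat \<Rightarrow> real mat" where
  "bidiag \<alpha> \<beta> k =
     mat (k + 1) k (\<lambda>(i, j). if i = j then \<alpha> (j + 1) else if i = j + 1 then \<beta> (j + 2) else 0)"

definition orthonormal_cols :: "real mat \<Rightarrow> bool" where
  "orthonormal_cols Q \<longleftrightarrow>
     (\<forall>i<dim_col Q. \<forall>j<dim_col Q. col Q i \<bullet> col Q j = (if i = j then 1 else 0))"

text \<open>
  Compact singular value decomposition of a matrix with \<open>k\<close> columns and full column rank, with
  pairwise distinct singular values \<open>\<theta> 1 > \<dots> > \<theta> k > 0\<close>.
\<close>

definition compact_svd :: "real mat \<Rightarrow> nat \<Rightarrow> real mat \<Rightarrow> (nat \<Rightarrow> real) \<Rightarrow> real mat \<Rightarrow> bool" where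
  "compact_svd B k Y \<theta> H \<longleftrightarrow>
     Y \<in> carrier_mat (dim_row B) k \<and> H \<in> carrier_mat (dim_col B) k \<and>
     orthonormal_cols Y \<and> orthonormal_cols H \<and>
     (\<forall>i\<in>{1..k}. \<theta> i > 0) \<and>
     (\<forall>i\<in>{1..k}. \<forall>j\<in>{1..k}. i < j \<longrightarrow> \<theta> i > \<theta> j) \<and>
     B = Y * mat_diag k (\<lambda>i. \<theta> (i + 1)) * transpose_mat H"

end

theory Submission
  imports Defs "Jordan_Normal_Form.Gauss_Jordan_Elimination"
begin

text \<open>
  For symmetric \<open>M\<close> the adjoint of \<open>v \<mapsto> A v\<close> is \<open>u \<mapsto> M\<^sup>\<dagger> A\<^sup>T u\<close>, since \<open>M\<^sup>\<dagger>\<close> maps into the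
  column space of \<open>M\<close> and \<open>M M\<^sup>\<dagger>\<close> is the orthogonal projection onto it. In matrix form the
  recurrences of the process are \<open>A V\<^sub>k = U\<^sub>k\<^sub>+\<^sub>1 B\<^sub>k\<close> and
  \<open>M\<^sup>\<dagger> A\<^sup>T U\<^sub>k\<^sub>+\<^sub>1 = V\<^sub>k B\<^sub>k\<^sup>T + \<alpha>\<^sub>k\<^sub>+\<^sub>1 v\<^sub>k\<^sub>+\<^sub>1 e\<^sub>k\<^sub>+\<^sub>1\<^sup>T\<close>;
  applying them to the singular vectors \<open>h\<^sub>i\<close> and \<open>y\<^sub>i\<close> gives both residuals. The
  Moore-Penrose inverse exists because a row echelon form yields a generalized inverse \<open>G\<close>
  of \<open>A\<^sup>T A\<close>, and then \<open>A G A\<^sup>T\<close> is the orthogonal projection onto the column space of \<open>A\<close>.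
\<close>

section \<open>Kernels of Gram matrices and cancellation of a transposed factor\<close>

lemma minus_vec_eq_iff:
  fixes x y z :: "'a :: ab_group_add vec"
  assumes "x \<in> carrier_vec n" "y \<in> carrier_vec n" "z \<in> carrier_vec n"
  shows "x - y = z \<longleftrightarrow> x = z + y"
  using assms by (auto simp: vec_eq_iff algebra_simps)

lemma scalar_prod_self_eq_0:
  fixes x :: "real vec"
  assumes "x \<bullet> x = 0"
  shows "x = 0\<^sub>v (dim_vec x)"
proof (rule eq_vecI)
  fix i assume i: "i < dim_vec (0\<^sub>v (dim_vec x))"
  have "(\<Sum>j\<in>{0..<dim_vec x}. x $ j * x $ j) = 0"
    using assms by (simp add: scalar_prod_def)
  then have "\<forall>j\<in>{0..<dim_vec x}. x $ j * x $ j = 0"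
    by (subst (asm) sum_nonneg_eq_0_iff) auto
  then show "x $ i = 0\<^sub>v (dim_vec x) $ i"
    using i by auto
qed simp

text \<open>The scalar product of A x with itself equals that of A^T A x with x, so the Gram matrix
  has no larger kernel than \<open>A\<close>.\<close>

lemma transpose_mult_mult_vec_eq_0:
  fixes A :: "real mat"
  assumes A: "A \<in> carrier_mat m n" and x: "x \<in> carrier_vec n"
    and 0: "transpose_mat A *\<^sub>v (A *\<^sub>v x) = 0\<^sub>v n"
  shows "A *\<^sub>v x = 0\<^sub>v m"
proof -
  have Ax: "A *\<^sub>v x \<in> carrier_vec m"
    using A x by simp
  have "(A *\<^sub>v x) \<bullet> (A *\<^sub>v x) = 0"
    using transpose_vec_mult_scalar[OF A x Ax] x 0 by simp
  from scalar_prod_self_eq_0[OF this] show ?thesis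
    using A by simp
qed

text \<open>The transposed factor may fail to be injective, but it can be cancelled in front of
  \<open>A\<close>: the differences of matching columns of \<open>K\<close> and \<open>K'\<close>
  lie in the kernel of the Gram matrix, hence in that of \<open>A\<close>.\<close>

lemma transpose_mult_mult_left_cancel:
  fixes A :: "real mat"
  assumes A: "A \<in> carrier_mat m n" and K: "K \<in> carrier_mat n l" and K': "K' \<in> carrier_mat n l"
    and eq: "transpose_mat A * (A * K) = transpose_mat A * (A * K')"
  shows "A * K = A * K'"
proof (rule mat_col_eqI)
  fix j assume "j < dim_col (A * K')"
  then have j: "j < l"
    using K' by simp
  let ?c = "col K j" and ?c' = "col K' j"
  have T: "transpose_mat A \<in> carrier_mat n m"
    using A by simp
  have c: "?c \<in> carrier_vec n" "?c' \<in> carrier_vec n"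
    using K K' by auto
  have "transpose_mat A *\<^sub>v (A *\<^sub>v ?c) = transpose_mat A *\<^sub>v (A *\<^sub>v ?c')"
    using arg_cong[OF eq, of "\<lambda>X. col X j"]
    by (simp only: col_mult2[OF T mult_carrier_mat[OF A K] j] col_mult2[OF T mult_carrier_mat[OF A K'] j]
        col_mult2[OF A K j] col_mult2[OF A K' j])
  then have "transpose_mat A *\<^sub>v (A *\<^sub>v (?c - ?c')) = 0\<^sub>v n"
    using A c by (simp add: mult_minus_distrib_mat_vec[of _ m n] mult_minus_distrib_mat_vec[of _ n m])
  then have "A *\<^sub>v (?c - ?c') = 0\<^sub>v m"
    using transpose_mult_mult_vec_eq_0[OF A] c by simp
  then have "A *\<^sub>v ?c = A *\<^sub>v ?c'"
    using A c by (simp add: mult_minus_distrib_mat_vec[of _ m n] minus_vec_eq_iff[of _ m])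
  then show "col (A * K) j = col (A * K') j"
    by (simp only: col_mult2[OF A K j] col_mult2[OF A K' j])
qed (use A K K' in auto)

section \<open>Generalized inverses and the Moore-Penrose inverse\<close>

text \<open>The pivot columns of \<open>E\<close> are distinct unit vectors. \<open>G\<close>
  selects them, so \<open>E * G\<close> is the diagonal projection onto the pivot rows.\<close>

lemma pivot_fun_generalized_inverse:
  fixes E :: "'a :: field mat"
  assumes E: "E \<in> carrier_mat nr nc" and f: "pivot_fun E f nc"
  shows "\<exists>G \<in> carrier_mat nc nr. E * G * E = E"
proof -
  note p = pivot_funD[OF _ f, of nr]
  have dr: "dim_row E = nr" using E by simp
  \<comment> \<open>A row without pivot has \<open>f i = nc\<close>, which is no row index of
    \<open>G\<close>; column \<open>i\<close> of \<open>G\<close> is then zero.\<close>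
  define G where "G = mat nc nr (\<lambda>(j, i). if j = f i then 1 else (0 :: 'a))"
  have G: "G \<in> carrier_mat nc nr"
    by (simp add: G_def)
  have EG: "E * G = mat_diag nr (\<lambda>i. if f i < nc then 1 else 0)"
  proof (rule eq_matI)
    fix i l
    assume "i < dim_row (mat_diag nr (\<lambda>i. if f i < nc then 1 else (0 :: 'a)))"
      "l < dim_col (mat_diag nr (\<lambda>i. if f i < nc then 1 else (0 :: 'a)))"
    then have i: "i < nr" and l: "l < nr"
      by (simp_all add: mat_diag_def)
    have "(E * G) $$ (i, l) = (\<Sum>j\<in>{0..<nc}. E $$ (i, j) * (if j = f l then 1 else 0))"
      using E i l by (simp add: G_def scalar_prod_def)
    also have "\<dots> = (\<Sum>j\<in>{0..<nc}. if j = f l then E $$ (i, j) else 0)"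
      by (intro sum.cong) auto
    also have "\<dots> = (if f l < nc then E $$ (i, f l) else 0)"
      by simp
    also have "\<dots> = (if i = l \<and> f i < nc then 1 else 0)"
      using p(4)[OF dr l] p(5)[OF dr l _ i] by auto
    finally show "(E * G) $$ (i, l) = mat_diag nr (\<lambda>i. if f i < nc then 1 else 0) $$ (i, l)"
      using i l by (auto simp: mat_diag_def)
  qed (use E G in \<open>auto simp: mat_diag_def\<close>)
  \<comment> \<open>The rows of \<open>E\<close> without a pivot vanish.\<close>
  have "E * G * E = E"
    unfolding EG mat_diag_mult_left[OF E]
  proof (rule eq_matI)
    fix i j assume "i < dim_row E" "j < dim_col E"
    then have i: "i < nr" and j: "j < nc"
      using E by auto
    show "mat nr nc (\<lambda>(i, j). (if f i < nc then 1 else 0) * E $$ (i, j)) $$ (i, j) = E $$ (i, j)"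
      using p(2)[OF dr i, of j] i j by auto
  qed (use E in auto)
  with G show ?thesis by blast
qed

text \<open>With \<open>E = P * A\<close> reduced and \<open>Q\<close> undoing \<open>P\<close>, a
  generalized inverse \<open>G\<close> of \<open>E\<close> yields \<open>G * P\<close> for
  \<open>A\<close>, because \<open>A * (G * P) * A\<close> equals
  \<open>Q * (E * G * E)\<close>.\<close>

lemma generalized_inverse_exists:
  fixes A :: "'a :: field mat"
  assumes A: "A \<in> carrier_mat nr nc"
  shows "\<exists>G \<in> carrier_mat nc nr. A * G * A = A"
proof -
  define E where "E = gauss_jordan_single A"
  note gj = gauss_jordan_single[OF A E_def[symmetric]]
  from gj(4) obtain P Q where E_eq: "E = P * A" and P: "P \<in> carrier_mat nr nr"
    and Q: "Q \<in> carrier_mat nr nr" and QP: "Q * P = 1\<^sub>m nr"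
    by blast
  from gj(2,3) obtain f where "pivot_fun E f nc"
    by (auto simp: row_echelon_form_def)
  from pivot_fun_generalized_inverse[OF gj(2) this]
  obtain G where G: "G \<in> carrier_mat nc nr" and EGE: "E * G * E = E"
    by blast
  have A_eq: "A = Q * E"
    using A P Q QP by (simp add: E_eq assoc_mult_mat[symmetric, of _ nr nr _ nr _ nc])
  have "A * (G * P) * A = A * G * (P * A)"
    using A G P by (simp add: assoc_mult_mat[of _ nr nc _ nr _ nr] assoc_mult_mat[of _ nr nr _ nr _ nc]
        assoc_mult_mat[of _ nr nc _ nr _ nc] assoc_mult_mat[of _ nc nr _ nr _ nc])
  also have "\<dots> = Q * E * G * E"
    by (simp add: A_eq[symmetric] E_eq[symmetric])
  also have "\<dots> = Q * (E * G * E)"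
    using Q gj(2) G by (simp add: assoc_mult_mat[of _ nr nr _ nc _ nr] assoc_mult_mat[of _ nr nr _ nr _ nc])
  also have "\<dots> = A"
    by (simp add: EGE A_eq[symmetric])
  finally show ?thesis
    using G P by (intro bexI[of _ "G * P"]) auto
qed

text \<open>These are two of the four Penrose conditions; the other symmetry comes from the
  transpose of \<open>A\<close>. The witness G A^T solves the normal equations.\<close>

lemma symmetric_right_generalized_inverse_exists:
  fixes A :: "real mat"
  assumes A: "A \<in> carrier_mat m n"
  shows "\<exists>X \<in> carrier_mat n m. A * X * A = A \<and> transpose_mat (A * X) = A * X"
proof -
  let ?T = "transpose_mat A"
  have T: "?T \<in> carrier_mat n m" using A by simp
  have TA: "?T * A \<in> carrier_mat n n" using A by simp
  from generalized_inverse_exists[OF TA] obtain G where G: "G \<in> carrier_mat n n"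
    and GG: "?T * A * G * (?T * A) = ?T * A"
    by blast
  define X where "X = G * ?T"
  have X: "X \<in> carrier_mat n m" using G T by (simp add: X_def)
  have XA: "X * A \<in> carrier_mat n n" using X A by simp
  have "?T * (A * (X * A)) = ?T * (A * 1\<^sub>m n)"
  proof -
    have "?T * (A * (X * A)) = ?T * A * G * (?T * A)"
      using A G T by (simp add: X_def assoc_mult_mat[of _ n n _ m _ n] assoc_mult_mat[of _ n m _ n _ n]
          assoc_mult_mat[of _ n n _ n _ n] assoc_mult_mat[of _ m n _ n _ n])
    then show ?thesis using GG A by simp
  qed
  from transpose_mult_mult_left_cancel[OF A XA _ this]
  have AXA: "A * X * A = A"
    using A X by (simp add: assoc_mult_mat[of _ m n _ m _ n])
  define S where "S = A * X"
  have S: "S \<in> carrier_mat m m" using A X by (simp add: S_def)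
  have tG: "transpose_mat G \<in> carrier_mat n n" using G by simp
  have c: "transpose_mat G * (?T * A) \<in> carrier_mat n n" using tG A by simp
  have tTA: "transpose_mat (?T * A) = ?T * A"
    using A by (simp add: transpose_mult[of _ n m _ n])
  \<comment> \<open>\<open>G\<close> may fail to be symmetric, but its transpose is again a
    generalized inverse of the symmetric Gram matrix, and the factor \<open>?T\<close> can be
    cancelled once more.\<close>
  have "?T * (A * (transpose_mat G * (?T * A))) = ?T * A * (transpose_mat G * (?T * A))"
    using A by (simp add: assoc_mult_mat[OF T A c])
  also have "\<dots> = transpose_mat (?T * A * G * (?T * A))"
    by (simp only: transpose_mult[OF mult_carrier_mat[OF TA G] TA] transpose_mult[OF TA G] tTA)
  also have "\<dots> = ?T * (A * 1\<^sub>m n)"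
    unfolding GG using A by (simp add: transpose_mult[of _ n m _ n])
  finally have "A * (transpose_mat G * (?T * A)) = A"
    using transpose_mult_mult_left_cancel[OF A c, of "1\<^sub>m n"] A by simp
  then have SA: "transpose_mat S * A = A"
    using A G tG T
    by (simp add: S_def X_def transpose_mult[of _ m n _ m] transpose_mult[of _ n n _ m]
        assoc_mult_mat[of _ m n _ n _ m] assoc_mult_mat[of _ m n _ m _ n] assoc_mult_mat[of _ n n _ m _ n])
  \<comment> \<open>\<open>S\<close> is shown to equal \<open>transpose_mat S * S\<close>, which is
    visibly symmetric.\<close>
  have "transpose_mat S * S = transpose_mat S * A * X"
    using A X S by (simp add: S_def assoc_mult_mat[of _ m m _ n _ m])
  then have SS: "transpose_mat S * S = S"
    unfolding SA by (simp only: S_def)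
  have "transpose_mat S = transpose_mat (transpose_mat S * S)"
    by (simp only: SS)
  also have "\<dots> = transpose_mat S * S"
    using S by (simp only: transpose_mult[of _ m m _ m] transpose_carrier_mat transpose_transpose)
  also have "\<dots> = S"
    by (rule SS)
  finally show ?thesis
    using X AXA by (auto simp: S_def)
qed

text \<open>One generalized inverse \<open>X\<close> makes \<open>A * X\<close> symmetric; another
  one, \<open>Z\<close>, obtained from the transpose of \<open>A\<close>, makes \<open>Z * A\<close>
  symmetric. The product \<open>Z * A * X\<close> combines them.\<close>

lemma moore_penrose_exists:
  assumes A: "A \<in> carrier_mat m n"
  shows "\<exists>X. is_moore_penrose A X"
proof -
  from symmetric_right_generalized_inverse_exists[OF A] obtain X where X: "X \<in> carrier_mat n m"
    and AXA: "A * X * A = A" and sX: "transpose_mat (A * X) = A * X"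
    by blast
  have T: "transpose_mat A \<in> carrier_mat n m" using A by simp
  from symmetric_right_generalized_inverse_exists[OF T] obtain W where W: "W \<in> carrier_mat m n"
    and TWT: "transpose_mat A * W * transpose_mat A = transpose_mat A"
    and sW: "transpose_mat (transpose_mat A * W) = transpose_mat A * W"
    by blast
  define Z where "Z = transpose_mat W"
  have Z: "Z \<in> carrier_mat n m" using W by (simp add: Z_def)
  have ZA: "Z * A = transpose_mat A * W"
    using sW A W by (simp add: Z_def transpose_mult[of _ n m _ n])
  have AZA: "A * Z * A = A"
  proof -
    have "A = transpose_mat (transpose_mat A * W * transpose_mat A)"
      by (simp add: TWT)
    also have "\<dots> = A * (Z * A)"
      using A W by (simp only: Z_def transpose_mult[of _ n n _ m] transpose_mult[of _ n m _ n]
          mult_carrier_mat[of _ n m _ n] T transpose_transpose)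
    finally show ?thesis
      using A Z by (simp add: assoc_mult_mat[of _ m n _ m _ n])
  qed
  \<comment> \<open>Since \<open>A * Y = A * X\<close> and \<open>Y * A = Z * A\<close>, both
    symmetries pass to \<open>Y\<close>.\<close>
  define Y where "Y = Z * A * X"
  note a = assoc_mult_mat[of _ m n _ m _ n] assoc_mult_mat[of _ m n _ n _ m] assoc_mult_mat[of _ n m _ n _ m]
    assoc_mult_mat[of _ n m _ m _ n] assoc_mult_mat[of _ n n _ m _ n] assoc_mult_mat[of _ m m _ m _ n]
    assoc_mult_mat[of _ n n _ n _ m] assoc_mult_mat[of _ m m _ n _ m]  assoc_mult_mat[of _ n m _ m _ m]
  have AY: "A * Y = A * X"
  proof -
    have "A * Y = A * Z * A * X" using A Z X by (simp add: Y_def a)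
    then show ?thesis by (simp add: AZA)
  qed
  have YA: "Y * A = Z * A"
  proof -
    have "Y * A = Z * (A * X * A)" using A Z X by (simp add: Y_def a)
    then show ?thesis by (simp add: AXA)
  qed
  have "Y * A * Y = Y"
  proof -
    have "Y * A * Y = Z * (A * Y)" unfolding YA using A Z X by (simp add: Y_def a)
    then show ?thesis unfolding AY using A Z X by (simp add: Y_def a)
  qed
  then have "is_moore_penrose A Y"
    unfolding is_moore_penrose_def AY YA
    using A X Z AXA sX sW by (auto simp: ZA Y_def)
  then show ?thesis ..
qed

text \<open>\<open>A * X\<close> and \<open>A * Y\<close> are both the orthogonal projection onto
  the column space of \<open>A\<close>, and \<open>X * A\<close> and \<open>Y * A\<close> both that
  onto the row space. Hence X = X A X = Y A X = Y A Y = Y.\<close>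

lemma moore_penrose_unique:
  assumes "is_moore_penrose A X" and "is_moore_penrose A Y"
  shows "X = Y"
proof -
  obtain m n where A: "A \<in> carrier_mat m n" by blast
  have X: "X \<in> carrier_mat n m" and Y: "Y \<in> carrier_mat n m"
    using assms A by (auto simp: is_moore_penrose_def)
  have X1: "A * X * A = A" and X2: "X * A * X = X" and X3: "transpose_mat (A * X) = A * X"
    and X4: "transpose_mat (X * A) = X * A"
    using assms(1) by (auto simp: is_moore_penrose_def)
  have Y1: "A * Y * A = A" and Y2: "Y * A * Y = Y" and Y3: "transpose_mat (A * Y) = A * Y"
    and Y4: "transpose_mat (Y * A) = Y * A"
    using assms(2) by (auto simp: is_moore_penrose_def)
  note a = assoc_mult_mat[of _ m n _ m _ n] assoc_mult_mat[of _ m n _ n _ m] assoc_mult_mat[of _ n m _ n _ m]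
    assoc_mult_mat[of _ n m _ m _ n] assoc_mult_mat[of _ n n _ m _ n] assoc_mult_mat[of _ m m _ m _ n]
    assoc_mult_mat[of _ n n _ n _ m] assoc_mult_mat[of _ m m _ n _ m] assoc_mult_mat[of _ n m _ m _ m]
    assoc_mult_mat[of _ m n _ m _ m] assoc_mult_mat[of _ n m _ n _ n]
  have "A * X = (A * Y * A) * X" by (simp only: Y1)
  also have "\<dots> = (A * Y) * (A * X)"
    using A X Y by (simp add: a)
  \<comment> \<open>Both factors are symmetric, so transposing swaps them and
    \<open>A * X * A = A\<close> becomes applicable.\<close>
  also have "\<dots> = transpose_mat (A * X * (A * Y))"
    using A X Y by (simp only: transpose_mult[of _ m m _ m] mult_carrier_mat[of _ m n _ m] X3 Y3)
  also have "A * X * (A * Y) = A * X * A * Y"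
    using A X Y by (simp add: a)
  also have "transpose_mat \<dots> = A * Y" by (simp only: X1 Y3)
  finally have AX: "A * X = A * Y" .
  have "X * A = X * (A * Y * A)" by (simp only: Y1)
  also have "\<dots> = (X * A) * (Y * A)"
    using A X Y by (simp add: a)
  also have "\<dots> = transpose_mat (Y * A * (X * A))"
    using A X Y by (simp only: transpose_mult[of _ n n _ n] mult_carrier_mat[of _ n m _ n] X4 Y4)
  also have "Y * A * (X * A) = Y * (A * X * A)"
    using A X Y by (simp add: a)
  also have "transpose_mat \<dots> = Y * A" by (simp only: X1 Y4)
  finally have XA: "X * A = Y * A" .
  have "X = Y * (A * X)"
    using X2 A X Y unfolding XA by (simp add: a)
  also have "\<dots> = Y"
    using Y2 A X Y unfolding AX by (simp add: a)
  finally show ?thesis .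
qed

lemma pinv_moore_penrose: "is_moore_penrose A (pinv A)"
proof -
  have "\<exists>X. is_moore_penrose A X"
    by (rule moore_penrose_exists[of A "dim_row A" "dim_col A"]) simp
  then have "\<exists>!X. is_moore_penrose A X"
    using moore_penrose_unique by blast
  then show ?thesis
    unfolding pinv_def by (rule theI')
qed

section \<open>The column space of a symmetric matrix and the adjoint operator\<close>

lemma column_space_eq:
  assumes "M \<in> carrier_mat n nc"
  shows "column_space M = {M *\<^sub>v z | z. z \<in> carrier_vec nc}"
  using assms vec_space.col_space_eq[OF assms] by auto

lemma zero_in_column_space:
  assumes M: "M \<in> carrier_mat n nc"
  shows "0\<^sub>v n \<in> column_space M"
proof -
  have "0\<^sub>v n = M *\<^sub>v 0\<^sub>v nc"
    using M by (auto intro!: eq_vecI)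
  then show ?thesis
    by (auto simp: column_space_eq[OF M])
qed

text \<open>Symmetry of \<open>pinv M * M\<close> brings a factor \<open>M\<close> to the left. Thus
  the pseudoinverse maps into the column space of \<open>M\<close>, with an explicit
  preimage.\<close>

lemma pinv_symmetric_eq:
  assumes M: "M \<in> carrier_mat n n" and sym: "transpose_mat M = M"
  shows "pinv M = M * (transpose_mat (pinv M) * pinv M)"
proof -
  note mp = pinv_moore_penrose[of M, unfolded is_moore_penrose_def]
  have X: "pinv M \<in> carrier_mat n n" using mp M by simp
  have "pinv M = transpose_mat (pinv M * M) * pinv M"
    using mp by simp
  also have "transpose_mat (pinv M * M) = M * transpose_mat (pinv M)"
    using M X sym by (simp add: transpose_mult[of _ n n _ n])
  finally show ?thesis
    using M X by (simp add: assoc_mult_mat[of _ n n _ n _ n])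
qed

text \<open>This is the transpose of \<open>M * pinv M * M = M\<close>. For v = M z,
  \<open>inner_M M v w\<close> puts two factors \<open>M\<close> in front of \<open>w\<close>; they
  collapse to one when \<open>w\<close> comes from the pseudoinverse.\<close>

lemma pinv_symmetric_mult_cancel:
  assumes M: "M \<in> carrier_mat n n" and sym: "transpose_mat M = M"
  shows "M * (M * pinv M) = M"
proof -
  note mp = pinv_moore_penrose[of M, unfolded is_moore_penrose_def]
  have X: "pinv M \<in> carrier_mat n n" using mp M by simp
  have "M * (M * pinv M) = transpose_mat M * transpose_mat (M * pinv M)"
    using mp by (simp add: sym)
  also have "\<dots> = transpose_mat (M * pinv M * M)"
    using M X by (simp only: transpose_mult[of _ n n _ n] mult_carrier_mat[of _ n n _ n])
  also have "\<dots> = M"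
    using mp by (simp add: sym)
  finally show ?thesis .
qed

text \<open>Membership, the adjoint identity and uniqueness together determine the description in
  \<open>adjoint_M\<close>. The identity is obtained by writing v = M z and moving matrices across
  the scalar product.\<close>

lemma adjoint_sve_op:
  assumes A: "A \<in> carrier_mat m n" and M: "M \<in> carrier_mat n n" and sym: "transpose_mat M = M"
    and u: "u \<in> carrier_vec m"
  shows "adjoint_M M (sve_op A M) u = pinv M *\<^sub>v (transpose_mat A *\<^sub>v u)"
proof -
  note mp = pinv_moore_penrose[of M, unfolded is_moore_penrose_def]
  have X: "pinv M \<in> carrier_mat n n" using mp M by simp
  note cs = column_space_eq[OF M]
  let ?a = "transpose_mat A *\<^sub>v u"
  let ?w = "pinv M *\<^sub>v ?a"
  have a: "?a \<in> carrier_vec n" using A u by simp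
  have w: "?w \<in> carrier_vec n" using X a by simp
  have wM: "?w = M *\<^sub>v ((transpose_mat (pinv M) * pinv M) *\<^sub>v ?a)"
    using arg_cong[OF pinv_symmetric_eq[OF M sym], of "\<lambda>Z. Z *\<^sub>v ?a"] M X a
    by (simp add: assoc_mult_mat_vec[of _ n n _ n])
  have wcs: "?w \<in> column_space M"
  proof -
    have "(transpose_mat (pinv M) * pinv M) *\<^sub>v ?a \<in> carrier_vec n"
      using X a by simp
    with wM show ?thesis unfolding cs by blast
  qed
  have adj: "sve_op A M v \<bullet> u = inner_M M v ?w" if v: "v \<in> column_space M" for v
  proof -
    from v obtain z where v_eq: "v = M *\<^sub>v z" and z: "z \<in> carrier_vec n"
      by (auto simp: cs)
    have vc: "v \<in> carrier_vec n" using v_eq M z by simp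
    have "inner_M M v ?w = z \<bullet> (M *\<^sub>v (M *\<^sub>v ?w))"
      using transpose_vec_mult_scalar[OF M, of "M *\<^sub>v ?w" z] M w z
      by (simp add: inner_M_def v_eq sym)
    also have "M *\<^sub>v (M *\<^sub>v ?w) = (M * (M * pinv M)) *\<^sub>v ?a"
      using M X a by (simp add: assoc_mult_mat_vec[of _ n n _ n])
    also have "\<dots> = M *\<^sub>v ?a"
      by (simp add: pinv_symmetric_mult_cancel[OF M sym])
    also have "z \<bullet> (M *\<^sub>v ?a) = v \<bullet> ?a"
      using transpose_vec_mult_scalar[OF M a z] by (simp add: v_eq sym)
    also have "\<dots> = (A *\<^sub>v v) \<bullet> u"
      using transpose_vec_mult_scalar[OF A vc u] comm_scalar_prod[OF a vc]
        comm_scalar_prod[of u m "A *\<^sub>v v"] A vc u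
      by simp
    finally show ?thesis
      using v by (simp add: sve_op_def)
  qed
  have unique: "w' = ?w"
    if w': "w' \<in> column_space M" and adj': "\<forall>v\<in>column_space M. sve_op A M v \<bullet> u = inner_M M v w'" for w'
  proof -
    from w' obtain z where w'_eq: "w' = M *\<^sub>v z" and z: "z \<in> carrier_vec n"
      by (auto simp: cs)
    have w'c: "w' \<in> carrier_vec n" using w'_eq M z by simp
    \<comment> \<open>A preimage under \<open>M\<close> of the difference of the two
      candidates.\<close>
    define y where "y = z - (transpose_mat (pinv M) * pinv M) *\<^sub>v ?a"
    have y: "y \<in> carrier_vec n" using z X a by (simp add: y_def)
    have My: "M *\<^sub>v y = w' - ?w"
      unfolding y_def w'_eq using M X a z
      by (subst wM) (simp add: mult_minus_distrib_mat_vec[of _ n n])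
    have Myc: "M *\<^sub>v y \<in> carrier_vec n" using M y by simp
    \<comment> \<open>With this test vector the difference of the two sides is the squared norm of M
      M y. So M M y vanishes, and symmetry of \<open>M\<close> gives M y = 0.\<close>
    have "inner_M M (M *\<^sub>v (M *\<^sub>v y)) w' = inner_M M (M *\<^sub>v (M *\<^sub>v y)) ?w"
      using adj adj' Myc by (auto simp: cs)
    then have "(M *\<^sub>v (M *\<^sub>v y)) \<bullet> (M *\<^sub>v (M *\<^sub>v y)) = 0"
      using M Myc w w'c unfolding inner_M_def
      by (subst (2) My) (simp add: mult_minus_distrib_mat_vec[of _ n n] scalar_prod_minus_distrib[of _ n])
    from scalar_prod_self_eq_0[OF this] have "M *\<^sub>v (M *\<^sub>v y) = 0\<^sub>v n"
      using M by simp
    then have "w' - ?w = 0\<^sub>v n"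
      using transpose_mult_mult_vec_eq_0[OF M y] by (simp add: sym My)
    then show ?thesis
      using w w'c by (simp add: minus_vec_eq_iff[of _ n])
  qed
  show ?thesis
    unfolding adjoint_M_def
  proof (rule the_equality)
    show "?w \<in> column_space M \<and> (\<forall>v\<in>column_space M. sve_op A M v \<bullet> u = inner_M M v ?w)"
      using adj wcs by blast
  qed (use unique in blast)
qed

section \<open>The recurrences in matrix form\<close>

lemma cols_upto_carrier [simp]: "cols_upto d w k \<in> carrier_mat d k"
  using mat_of_cols_carrier(1)[of d "map w [1..<k + 1]"] by (simp add: cols_upto_def del: upt_Suc)

lemma cols_upto_mult_vec_index:
  assumes "i < d" and "y \<in> carrier_vec k"
  shows "(cols_upto d w k *\<^sub>v y) $ i = (\<Sum>j<k. w (j + 1) $ i * y $ j)"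
proof -
  have "row (cols_upto d w k) i $ j = w (j + 1) $ i" if "j < k" for j
    using assms that by (simp add: cols_upto_def mat_of_cols_index del: upt_Suc)
  then show ?thesis
    using assms carrier_matD[OF cols_upto_carrier[of d w k]]
    by (simp add: scalar_prod_def lessThan_atLeast0)
qed

lemma bidiag_carrier [simp]: "bidiag \<alpha> \<beta> k \<in> carrier_mat (k + 1) k"
  by (simp add: bidiag_def)

text \<open>Column \<open>j\<close> of the bidiagonal matrix has entries only in rows
  \<open>j\<close> and \<open>j + 1\<close>, so it combines \<open>u (j + 1)\<close> and
  \<open>u (j + 2)\<close> exactly as the recurrence for \<open>v (j + 1)\<close> does.\<close>

lemma cols_upto_mult_bidiag:
  assumes A: "A \<in> carrier_mat m n" and v: "\<And>j. 1 \<le> j \<Longrightarrow> j \<le> k \<Longrightarrow> v j \<in> carrier_vec n"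
    and u: "\<And>j. 1 \<le> j \<Longrightarrow> j \<le> k + 1 \<Longrightarrow> u j \<in> carrier_vec m"
    and rec: "\<And>j. 1 \<le> j \<Longrightarrow> j \<le> k \<Longrightarrow> A *\<^sub>v v j = \<alpha> j \<cdot>\<^sub>v u j + \<beta> (j + 1) \<cdot>\<^sub>v u (j + 1)"
  shows "A * cols_upto n v k = cols_upto m u (k + 1) * bidiag \<alpha> \<beta> k"
proof (rule mat_col_eqI)
  fix j assume "j < dim_col (cols_upto m u (k + 1) * bidiag \<alpha> \<beta> k)"
  then have j: "j < k" by (simp add: bidiag_def)
  let ?B = "bidiag \<alpha> \<beta> k"
  have "col (cols_upto n v k) j = v (j + 1)"
    using j v[of "j + 1"] by (simp add: cols_upto_def col_mat_of_cols del: upt_Suc)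
  then have "col (A * cols_upto n v k) j = \<alpha> (j + 1) \<cdot>\<^sub>v u (j + 1) + \<beta> (j + 2) \<cdot>\<^sub>v u (j + 2)"
    using rec[of "j + 1"] j A by (simp add: col_mult2[of _ m n _ k])
  also have "\<dots> = cols_upto m u (k + 1) *\<^sub>v col ?B j"
  proof (rule eq_vecI)
    fix i assume "i < dim_vec (cols_upto m u (k + 1) *\<^sub>v col ?B j)"
    then have i: "i < m" by (simp add: cols_upto_def)
    have "(cols_upto m u (k + 1) *\<^sub>v col ?B j) $ i = (\<Sum>l<k + 1. u (l + 1) $ i * col ?B j $ l)"
      by (rule cols_upto_mult_vec_index[OF i]) (rule col_carrier_vec[OF j bidiag_carrier])
    also have "\<dots> = (\<Sum>l<k + 1. (if l = j then u (l + 1) $ i * \<alpha> (j + 1) else 0)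
        + (if l = j + 1 then u (l + 1) $ i * \<beta> (j + 2) else 0))"
      using j by (intro sum.cong) (auto simp: bidiag_def)
    also have "\<dots> = u (j + 1) $ i * \<alpha> (j + 1) + u (j + 2) $ i * \<beta> (j + 2)"
      using j by (simp add: sum.distrib)
    finally show "(\<alpha> (j + 1) \<cdot>\<^sub>v u (j + 1) + \<beta> (j + 2) \<cdot>\<^sub>v u (j + 2)) $ i
        = (cols_upto m u (k + 1) *\<^sub>v col ?B j) $ i"
      using i j u[of "j + 1"] u[of "j + 2"] by (simp add: mult.commute)
  qed (use j u[of "j + 2"] in \<open>simp add: cols_upto_def\<close>)
  also have "\<dots> = col (cols_upto m u (k + 1) * ?B) j"
    by (rule col_mult2[OF cols_upto_carrier bidiag_carrier j, symmetric])
  finally show "col (A * cols_upto n v k) j = col (cols_upto m u (k + 1) * ?B) j" .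
qed (use A in \<open>auto simp: cols_upto_def bidiag_def\<close>)

text \<open>Meant for \<open>P = pinv M * transpose_mat A\<close>. There are \<open>k + 1\<close>
  vectors \<open>u\<close> but only \<open>k\<close> columns in \<open>?V\<close>, so the last
  recurrence leaves a multiple of \<open>v (k + 1)\<close>. Applying everything to \<open>y\<close>
  avoids a separate rank-one matrix.\<close>

lemma mult_cols_upto_vec_bidiag:
  assumes P: "P \<in> carrier_mat n m" and v: "\<And>j. j \<le> k + 1 \<Longrightarrow> v j \<in> carrier_vec n"
    and u: "\<And>j. 1 \<le> j \<Longrightarrow> j \<le> k + 1 \<Longrightarrow> u j \<in> carrier_vec m"
    and v0: "v 0 = 0\<^sub>v n"
    and rec: "\<And>j. 1 \<le> j \<Longrightarrow> j \<le> k + 1 \<Longrightarrow> P *\<^sub>v u j = \<alpha> j \<cdot>\<^sub>v v j + \<beta> j \<cdot>\<^sub>v v (j - 1)"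
    and y: "y \<in> carrier_vec (k + 1)"
  shows "P *\<^sub>v (cols_upto m u (k + 1) *\<^sub>v y)
    = cols_upto n v k *\<^sub>v (transpose_mat (bidiag \<alpha> \<beta> k) *\<^sub>v y) + (\<alpha> (k + 1) * y $ k) \<cdot>\<^sub>v v (k + 1)"
    (is "_ = ?V *\<^sub>v (?BT *\<^sub>v y) + _")
proof -
  have PU: "P * cols_upto m u (k + 1)
    = mat n (k + 1) (\<lambda>(i, j). \<alpha> (j + 1) * v (j + 1) $ i + \<beta> (j + 1) * v j $ i)"
  proof (rule mat_col_eqI)
    fix j assume "j < dim_col (mat n (k + 1) (\<lambda>(i, j). \<alpha> (j + 1) * v (j + 1) $ i + \<beta> (j + 1) * v j $ i))"
    then have j: "j < k + 1" by simp
    have "col (cols_upto m u (k + 1)) j = u (j + 1)"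
      using j u[of "j + 1"] by (simp add: cols_upto_def col_mat_of_cols del: upt_Suc)
    then have "col (P * cols_upto m u (k + 1)) j = \<alpha> (j + 1) \<cdot>\<^sub>v v (j + 1) + \<beta> (j + 1) \<cdot>\<^sub>v v j"
      using rec[of "j + 1"] j P by (simp add: col_mult2[of _ n m _ "k + 1"])
    then show "col (P * cols_upto m u (k + 1)) j
      = col (mat n (k + 1) (\<lambda>(i, j). \<alpha> (j + 1) * v (j + 1) $ i + \<beta> (j + 1) * v j $ i)) j"
      using j v[of j] v[of "j + 1"] by (auto intro!: eq_vecI)
  qed (use P in \<open>auto simp: cols_upto_def\<close>)
  have BT: "(?BT *\<^sub>v y) $ j = \<alpha> (j + 1) * y $ j + \<beta> (j + 2) * y $ (j + 1)" if j: "j < k" for j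
  proof -
    have "(?BT *\<^sub>v y) $ j = (\<Sum>l\<in>{0..<k + 1}. bidiag \<alpha> \<beta> k $$ (l, j) * y $ l)"
      using j y by (auto simp: scalar_prod_def bidiag_def intro!: sum.cong)
    also have "\<dots> = (\<Sum>l\<in>{0..<k + 1}. (if l = j then \<alpha> (j + 1) * y $ l else 0)
        + (if l = j + 1 then \<beta> (j + 2) * y $ l else 0))"
      using j by (intro sum.cong) (auto simp: bidiag_def)
    also have "\<dots> = \<alpha> (j + 1) * y $ j + \<beta> (j + 2) * y $ (j + 1)"
      using j by (simp add: sum.distrib)
    finally show ?thesis .
  qed
  have "(P * cols_upto m u (k + 1)) *\<^sub>v y = ?V *\<^sub>v (?BT *\<^sub>v y) + (\<alpha> (k + 1) * y $ k) \<cdot>\<^sub>v v (k + 1)"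
  proof (rule eq_vecI)
    fix i assume "i < dim_vec (?V *\<^sub>v (?BT *\<^sub>v y) + (\<alpha> (k + 1) * y $ k) \<cdot>\<^sub>v v (k + 1))"
    then have i: "i < n" using v[of "k + 1"] by simp
    have "((P * cols_upto m u (k + 1)) *\<^sub>v y) $ i
        = (\<Sum>l<k + 1. \<alpha> (l + 1) * v (l + 1) $ i * y $ l + \<beta> (l + 1) * v l $ i * y $ l)"
      unfolding PU using i y
      by (auto simp: scalar_prod_def lessThan_atLeast0 distrib_right intro!: sum.cong)
    also have "\<dots> = (\<Sum>l<k + 1. \<alpha> (l + 1) * v (l + 1) $ i * y $ l) + (\<Sum>l<k + 1. \<beta> (l + 1) * v l $ i * y $ l)"
      by (rule sum.distrib)
    \<comment> \<open>The term for \<open>l = 0\<close> vanishes because \<open>v 0\<close> is zero;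
      the shift lets the sum run over the columns of \<open>?V\<close>.\<close>
    also have "(\<Sum>l<k + 1. \<beta> (l + 1) * v l $ i * y $ l) = (\<Sum>l<k. \<beta> (l + 2) * v (l + 1) $ i * y $ (l + 1))"
      using i by (simp add: sum.lessThan_Suc_shift v0 del: sum.lessThan_Suc)
    \<comment> \<open>The term for \<open>l = k\<close> is split off as the residual; the others
      pair up to the entries of \<open>?BT *\<^sub>v y\<close>.\<close>
    also have "(\<Sum>l<k + 1. \<alpha> (l + 1) * v (l + 1) $ i * y $ l) + \<dots>
        = (\<Sum>l<k. v (l + 1) $ i * (\<alpha> (l + 1) * y $ l + \<beta> (l + 2) * y $ (l + 1)))
          + \<alpha> (k + 1) * y $ k * v (k + 1) $ i"
      by (simp add: sum.distrib distrib_left mult_ac)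
    also have "(\<Sum>l<k. v (l + 1) $ i * (\<alpha> (l + 1) * y $ l + \<beta> (l + 2) * y $ (l + 1))) = (?V *\<^sub>v (?BT *\<^sub>v y)) $ i"
    proof -
      have "transpose_mat (bidiag \<alpha> \<beta> k) \<in> carrier_mat k (k + 1)"
        by (rule transpose_carrier_mat[THEN iffD2, OF bidiag_carrier])
      from cols_upto_mult_vec_index[OF i mult_mat_vec_carrier[OF this y], of v] show ?thesis
        by (auto simp: BT simp del: index_mult_mat_vec intro!: sum.cong)
    qed
    finally show "((P * cols_upto m u (k + 1)) *\<^sub>v y) $ i
        = (?V *\<^sub>v (?BT *\<^sub>v y) + (\<alpha> (k + 1) * y $ k) \<cdot>\<^sub>v v (k + 1)) $ i"
      using i v[of "k + 1"] by (simp del: index_mult_mat_vec add: cols_upto_def)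
  qed (use P v[of "k + 1"] in auto)
  then show ?thesis
    by (simp only: assoc_mult_mat_vec[OF P cols_upto_carrier y])
qed

section \<open>Iterates and their combinations in the column space\<close>

text \<open>Needed because \<open>sve_op\<close> is specified on the column space only. By
  induction, each right-hand side is a value of the pseudoinverse minus a multiple of the preceding
  vector.\<close>

lemma gGKB_in_column_space:
  assumes A: "A \<in> carrier_mat m n" and M: "M \<in> carrier_mat n n" and sym: "transpose_mat M = M"
    and process: "gGKB A M b \<alpha> \<beta> u v"
  shows "v i \<in> column_space M"
proof (induction i)
  case 0
  show ?case
    using process A zero_in_column_space[OF M] by (simp add: gGKB_def)
next
  case (Suc i)
  show ?case
  \<comment> \<open>A vanishing coefficient cannot be divided out, but then the process sets the
    vector itself to zero.\<close>
  proof (cases "\<alpha> (Suc i) = 0")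
    case True
    then show ?thesis
      using process A zero_in_column_space[OF M] by (simp add: gGKB_def)
  next
    case False
    from Suc.IH obtain z where v_i: "v i = M *\<^sub>v z" and z: "z \<in> carrier_vec n"
      by (auto simp: column_space_eq[OF M])
    let ?X = "pinv M" and ?a = "transpose_mat A *\<^sub>v u (Suc i)"
    have X: "?X \<in> carrier_mat n n"
      using pinv_moore_penrose[of M] M by (simp add: is_moore_penrose_def)
    have a: "?a \<in> carrier_vec n"
      using process A by (simp add: gGKB_def)
    have w: "(transpose_mat ?X * ?X) *\<^sub>v ?a \<in> carrier_vec n"
      using X a by simp
    have v: "v (Suc i) \<in> carrier_vec n"
      using process A by (simp add: gGKB_def)
    have "?X *\<^sub>v ?a = M *\<^sub>v ((transpose_mat ?X * ?X) *\<^sub>v ?a)"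
      using arg_cong[OF pinv_symmetric_eq[OF M sym], of "\<lambda>Z. Z *\<^sub>v ?a"] M X a
      by (simp add: assoc_mult_mat_vec[of _ n n _ n])
    moreover have "\<alpha> (Suc i) \<cdot>\<^sub>v v (Suc i) = ?X *\<^sub>v ?a - \<beta> (Suc i) \<cdot>\<^sub>v v i"
      using process unfolding gGKB_def by (metis diff_Suc_1 le_add1 plus_1_eq_Suc)
    ultimately have "\<alpha> (Suc i) \<cdot>\<^sub>v v (Suc i)
        = M *\<^sub>v ((transpose_mat ?X * ?X) *\<^sub>v ?a - \<beta> (Suc i) \<cdot>\<^sub>v z)"
      using M w z by (simp only: v_i mult_minus_distrib_mat_vec[of _ n n] mult_mat_vec[of _ n n] smult_carrier_vec)
    then have "(1 / \<alpha> (Suc i)) \<cdot>\<^sub>v (\<alpha> (Suc i) \<cdot>\<^sub>v v (Suc i))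
        = M *\<^sub>v ((1 / \<alpha> (Suc i)) \<cdot>\<^sub>v ((transpose_mat ?X * ?X) *\<^sub>v ?a - \<beta> (Suc i) \<cdot>\<^sub>v z))"
      using M w z by (simp add: mult_mat_vec[of _ n n])
    then have "v (Suc i) = M *\<^sub>v ((1 / \<alpha> (Suc i)) \<cdot>\<^sub>v ((transpose_mat ?X * ?X) *\<^sub>v ?a - \<beta> (Suc i) \<cdot>\<^sub>v z))"
      using False by (simp add: smult_smult_assoc)
    then show ?thesis
      using w z by (auto simp: column_space_eq[OF M])
  qed
qed

text \<open>Preimages of the columns under \<open>M\<close> are collected in a matrix, and
  \<open>M\<close> is applied to the same combination of these preimages.\<close>

lemma cols_upto_mult_vec_in_column_space:
  assumes M: "M \<in> carrier_mat n nc" and w: "\<And>j. 1 \<le> j \<Longrightarrow> j \<le> k \<Longrightarrow> w j \<in> column_space M"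
    and y: "y \<in> carrier_vec k"
  shows "cols_upto n w k *\<^sub>v y \<in> column_space M"
proof -
  have "\<forall>j. \<exists>z. 1 \<le> j \<longrightarrow> j \<le> k \<longrightarrow> z \<in> carrier_vec nc \<and> w j = M *\<^sub>v z"
    using w by (auto simp: column_space_eq[OF M])
  then obtain z where z: "\<And>j. 1 \<le> j \<Longrightarrow> j \<le> k \<Longrightarrow> z j \<in> carrier_vec nc \<and> w j = M *\<^sub>v z j"
    by metis
  have "cols_upto n w k = M * cols_upto nc z k"
  proof (rule mat_col_eqI)
    fix j assume "j < dim_col (M * cols_upto nc z k)"
    then have j: "j < k" by (simp add: cols_upto_def del: upt_Suc)
    have "col (cols_upto n w k) j = w (j + 1)" "col (cols_upto nc z k) j = z (j + 1)"
      using j z[of "j + 1"] M by (simp_all add: cols_upto_def col_mat_of_cols del: upt_Suc)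
    then show "col (cols_upto n w k) j = col (M * cols_upto nc z k) j"
      using z[of "j + 1"] j M by (simp add: col_mult2[of _ n nc _ k])
  qed (use M in \<open>auto simp: cols_upto_def\<close>)
  then have "cols_upto n w k *\<^sub>v y = M *\<^sub>v (cols_upto nc z k *\<^sub>v y)"
    using M y by (simp add: assoc_mult_mat_vec[of _ n nc _ k])
  moreover have "cols_upto nc z k *\<^sub>v y \<in> carrier_vec nc"
    using y by (rule mult_mat_vec_carrier[OF cols_upto_carrier])
  ultimately show ?thesis
    by (auto simp: column_space_eq[OF M])
qed

section \<open>Action of a matrix on its singular vectors\<close>

lemma orthonormal_cols_transpose_mult_col:
  assumes Q: "Q \<in> carrier_mat d k" and orth: "orthonormal_cols Q" and i: "i < k"
  shows "transpose_mat Q *\<^sub>v col Q i = unit_vec k i"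
  using assms by (auto intro!: eq_vecI simp: orthonormal_cols_def unit_vec_def)

lemma mult_mat_diag_unit_vec:
  fixes Y :: "'a :: comm_semiring_1 mat"
  assumes Y: "Y \<in> carrier_mat d k" and i: "i < k"
  shows "(Y * mat_diag k f) *\<^sub>v unit_vec k i = f i \<cdot>\<^sub>v col Y i"
proof (rule eq_vecI)
  fix l assume "l < dim_vec (f i \<cdot>\<^sub>v col Y i)"
  then have l: "l < d" using Y by simp
  have "((Y * mat_diag k f) *\<^sub>v unit_vec k i) $ l = row (Y * mat_diag k f) l $ i"
    using Y l i by simp
  then show "((Y * mat_diag k f) *\<^sub>v unit_vec k i) $ l = (f i \<cdot>\<^sub>v col Y i) $ l"
    using Y l i by (simp add: mat_diag_mult_right[OF Y] mult.commute)
qed (use Y in simp)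

text \<open>Orthonormality turns \<open>transpose_mat H *\<^sub>v col H i\<close> into a unit
  vector, which picks a single scaled column of \<open>Y\<close>.\<close>

lemma compact_svd_right:
  assumes svd: "compact_svd B k Y \<theta> H" and i: "i < k"
  shows "B *\<^sub>v col H i = \<theta> (i + 1) \<cdot>\<^sub>v col Y i"
proof -
  let ?D = "mat_diag k (\<lambda>i. \<theta> (i + 1))"
  have Y: "Y \<in> carrier_mat (dim_row B) k" and H: "H \<in> carrier_mat (dim_col B) k"
    and orth: "orthonormal_cols H" and B: "B = Y * ?D * transpose_mat H"
    using svd by (auto simp: compact_svd_def)
  have "B *\<^sub>v col H i = (Y * ?D * transpose_mat H) *\<^sub>v col H i"
    using B by simp
  also have "\<dots> = (Y * ?D) *\<^sub>v (transpose_mat H *\<^sub>v col H i)"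
    by (rule assoc_mult_mat_vec[of _ "dim_row B" k _ "dim_col B"])
      (use Y H i in \<open>auto intro!: mult_carrier_mat[of _ _ k]\<close>)
  finally show ?thesis
    by (simp only: orthonormal_cols_transpose_mult_col[OF H orth i] mult_mat_diag_unit_vec[OF Y i])
qed

text \<open>The diagonal factor is symmetric, so left and right singular vectors change places. This
  reduces the action of the transposed matrix on the columns of \<open>Y\<close> to
  \<open>compact_svd_right\<close>.\<close>

lemma compact_svd_transpose:
  assumes "compact_svd B k Y \<theta> H"
  shows "compact_svd (transpose_mat B) k H \<theta> Y"
proof -
  let ?D = "mat_diag k (\<lambda>i. \<theta> (i + 1))"
  have Y: "Y \<in> carrier_mat (dim_row B) k" and H: "H \<in> carrier_mat (dim_col B) k"
    and B: "B = Y * ?D * transpose_mat H"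
    using assms by (auto simp: compact_svd_def)
  have YD: "Y * ?D \<in> carrier_mat (dim_row B) k"
    using Y by (rule mult_carrier_mat) simp
  have D: "transpose_mat ?D = ?D"
    by (auto simp: mat_diag_def)
  have "transpose_mat B = transpose_mat (Y * ?D * transpose_mat H)"
    using B by simp
  also have "\<dots> = H * transpose_mat (Y * ?D)"
    using transpose_mult[OF YD, of "transpose_mat H" "dim_col B"] H by simp
  also have "transpose_mat (Y * ?D) = ?D * transpose_mat Y"
    using transpose_mult[OF Y, of ?D k] D by simp
  also have "H * \<dots> = H * ?D * transpose_mat Y"
    by (rule assoc_mult_mat[symmetric, of _ "dim_col B" k _ k _ "dim_row B"]) (use Y H in auto)
  finally show ?thesis
    using assms unfolding compact_svd_def index_transpose_mat by blast
qed

section \<open>Residuals of the approximate singular triplets\<close>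

theorem theorem5p1:
  fixes A L M Y H :: "real mat" and b :: "real vec"
    and m n p k :: nat
    and \<alpha> \<beta> \<theta> :: "nat \<Rightarrow> real" and u v :: "nat \<Rightarrow> real vec"
    and c :: "nat \<Rightarrow> real" and p\<^sub>A x :: "nat \<Rightarrow> real vec"
  assumes A: "A \<in> carrier_mat m n"
    and L: "L \<in> carrier_mat p n"
    and M: "M = transpose_mat A * A + transpose_mat L * L"
    and b: "b \<in> carrier_vec m" "b \<noteq> 0\<^sub>v m"
    and process: "gGKB A M b \<alpha> \<beta> u v"
    and k: "k \<ge> 1" "\<And>i. i \<in> {1..k} \<Longrightarrow> \<alpha> i * \<beta> i \<noteq> 0"
    and svd: "compact_svd (bidiag \<alpha> \<beta> k) k Y \<theta> H"
    and c: "\<And>i. i \<in> {1..k} \<Longrightarrow> c i = \<theta> i"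
    and p\<^sub>A: "\<And>i. i \<in> {1..k} \<Longrightarrow> p\<^sub>A i = cols_upto m u (k + 1) *\<^sub>v col Y (i - 1)"
    and x: "\<And>i. i \<in> {1..k} \<Longrightarrow> x i = cols_upto n v k *\<^sub>v col H (i - 1)"
  shows "\<forall>i\<in>{1..k}.
      sve_op A M (x i) - c i \<cdot>\<^sub>v p\<^sub>A i = 0\<^sub>v m \<and>
      adjoint_M M (sve_op A M) (p\<^sub>A i) - c i \<cdot>\<^sub>v x i
        = (\<alpha> (k + 1) * (unit_vec (k + 1) k \<bullet> col Y (i - 1))) \<cdot>\<^sub>v v (k + 1)"
proof
  fix i assume i: "i \<in> {1..k}"
  \<comment> \<open>Triplets are numbered from 1 and matrix columns from 0, so column
    \<open>j\<close> belongs to \<open>\<theta> i\<close>.\<close>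
  define j where "j = i - 1"
  have j: "j < k" "j + 1 = i" using i by (auto simp: j_def)
  have Mc: "M \<in> carrier_mat n n" using A L by (simp add: M)
  have sym: "transpose_mat M = M"
    using A L by (simp add: M transpose_add[of _ n n] transpose_mult[of _ n m _ n] transpose_mult[of _ n p _ n])
  have X: "pinv M \<in> carrier_mat n n"
    using pinv_moore_penrose[of M] Mc by (simp add: is_moore_penrose_def)
  have v0: "v 0 = 0\<^sub>v n" using process A by (simp add: gGKB_def)
  have uc: "u l \<in> carrier_vec m" and vc': "v l \<in> carrier_vec n" if "1 \<le> l" for l
    using process A that by (auto simp: gGKB_def)
  \<comment> \<open>The index 0 is included because the first recurrence refers to
    \<open>v 0\<close>.\<close>
  have vc: "v l \<in> carrier_vec n" for l
    using vc'[of l] v0 by (cases l) auto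
  have rec_A: "A *\<^sub>v v l = \<alpha> l \<cdot>\<^sub>v u l + \<beta> (l + 1) \<cdot>\<^sub>v u (l + 1)" if l: "1 \<le> l" for l
  proof -
    have "A *\<^sub>v v l - \<alpha> l \<cdot>\<^sub>v u l = \<beta> (l + 1) \<cdot>\<^sub>v u (l + 1)"
      using process l by (simp add: gGKB_def)
    then show ?thesis
      using A vc[of l] uc[OF l] uc[of "l + 1"]
      by (simp add: minus_vec_eq_iff[of _ m] comm_add_vec[of _ m "\<alpha> l \<cdot>\<^sub>v u l"])
  qed
  have rec_P: "(pinv M * transpose_mat A) *\<^sub>v u l = \<alpha> l \<cdot>\<^sub>v v l + \<beta> l \<cdot>\<^sub>v v (l - 1)"
    if l: "1 \<le> l" for l
  proof -
    have "pinv M *\<^sub>v (transpose_mat A *\<^sub>v u l) - \<beta> l \<cdot>\<^sub>v v (l - 1) = \<alpha> l \<cdot>\<^sub>v v l"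
      using process l by (simp add: gGKB_def)
    then show ?thesis
      using X A uc[OF l] vc
      by (simp add: assoc_mult_mat_vec[of _ n n _ m] minus_vec_eq_iff[of _ n])
  qed
  let ?U = "cols_upto m u (k + 1)" and ?V = "cols_upto n v k" and ?B = "bidiag \<alpha> \<beta> k"
  let ?y = "col Y j" and ?h = "col H j"
  have y: "?y \<in> carrier_vec (k + 1)" and h: "?h \<in> carrier_vec k"
    using svd j(1) by (auto simp: compact_svd_def bidiag_def intro!: col_carrier_vec)
  have xi: "x i = ?V *\<^sub>v ?h" and pi: "p\<^sub>A i = ?U *\<^sub>v ?y" and ci: "c i = \<theta> i"
    using x[OF i] p\<^sub>A[OF i] c[OF i] by (simp_all add: j_def)
  have xc: "x i \<in> carrier_vec n" and pc: "p\<^sub>A i \<in> carrier_vec m"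
    unfolding xi pi by (intro mult_mat_vec_carrier[OF cols_upto_carrier] h y)+
  \<comment> \<open>The restricted operator can be evaluated only after this membership is
    known.\<close>
  have "x i \<in> column_space M"
    unfolding xi
    by (rule cols_upto_mult_vec_in_column_space[OF Mc gGKB_in_column_space[OF A Mc sym process] h])
  then have "sve_op A M (x i) = A *\<^sub>v (?V *\<^sub>v ?h)"
    by (simp add: sve_op_def xi)
  also have "\<dots> = (?U * ?B) *\<^sub>v ?h"
    using assoc_mult_mat_vec[OF A cols_upto_carrier h, of v] cols_upto_mult_bidiag[OF A, of k v u \<alpha> \<beta>] vc uc rec_A
    by simp
  also have "\<dots> = ?U *\<^sub>v (\<theta> i \<cdot>\<^sub>v ?y)"
    using compact_svd_right[OF svd j(1)] assoc_mult_mat_vec[OF cols_upto_carrier bidiag_carrier h] j(2)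
    by simp
  also have "\<dots> = c i \<cdot>\<^sub>v p\<^sub>A i"
    unfolding pi ci by (rule mult_mat_vec[OF cols_upto_carrier y])
  finally have 1: "sve_op A M (x i) - c i \<cdot>\<^sub>v p\<^sub>A i = 0\<^sub>v m"
    using pc by simp
  have P: "pinv M * transpose_mat A \<in> carrier_mat n m" using X A by simp
  have "adjoint_M M (sve_op A M) (p\<^sub>A i) = pinv M *\<^sub>v (transpose_mat A *\<^sub>v p\<^sub>A i)"
    by (rule adjoint_sve_op[OF A Mc sym pc])
  also have "\<dots> = (pinv M * transpose_mat A) *\<^sub>v (?U *\<^sub>v ?y)"
    using X A pc by (simp add: pi assoc_mult_mat_vec[of _ n n _ m])
  also have "\<dots> = ?V *\<^sub>v (transpose_mat ?B *\<^sub>v ?y) + (\<alpha> (k + 1) * ?y $ k) \<cdot>\<^sub>v v (k + 1)"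
    by (rule mult_cols_upto_vec_bidiag[OF P vc uc v0 rec_P y])
  \<comment> \<open>In the transposed decomposition \<open>?y\<close> takes the role of a right
    singular vector; the first summand becomes a multiple of \<open>x i\<close>, and the second one
    is the residual.\<close>
  also have "transpose_mat ?B *\<^sub>v ?y = \<theta> i \<cdot>\<^sub>v ?h"
    using compact_svd_right[OF compact_svd_transpose[OF svd] j(1)] j(2) by simp
  also have "?V *\<^sub>v \<dots> = c i \<cdot>\<^sub>v x i"
    unfolding xi ci by (rule mult_mat_vec[OF cols_upto_carrier h])
  \<comment> \<open>Counted from 0, coordinate \<open>k\<close> is the last one, selected by the
    unit vector with index k+1 in the usual numbering.\<close>
  also have "?y $ k = unit_vec (k + 1) k \<bullet> ?y"
    using scalar_prod_left_unit[OF y, of k] by simp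
  finally have "adjoint_M M (sve_op A M) (p\<^sub>A i) - c i \<cdot>\<^sub>v x i
      = (\<alpha> (k + 1) * (unit_vec (k + 1) k \<bullet> ?y)) \<cdot>\<^sub>v v (k + 1)"
    using xc vc[of "k + 1"] by (auto intro!: eq_vecI)
  with 1 show "sve_op A M (x i) - c i \<cdot>\<^sub>v p\<^sub>A i = 0\<^sub>v m \<and>
      adjoint_M M (sve_op A M) (p\<^sub>A i) - c i \<cdot>\<^sub>v x i
        = (\<alpha> (k + 1) * (unit_vec (k + 1) k \<bullet> col Y (i - 1))) \<cdot>\<^sub>v v (k + 1)"
    by (simp add: j_def)
qed

end
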